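(* The map $\tau:\mathbf{DR}\to\mathcal R/\sim$, $\tau((A|B))=[\sup A]=[\inf B]$, is bijective.
   Context: $\mathbb N=\{1,2,3,\dots\}$ and $\mathcal Z_{10}=\{0,1,\dots,9\}$. $\mathcal R$ is the set of all formal decimals $x=x_0.x_1x_2x_3\cdots$ with $x_0\in\mathbb Z$ and $x_k\in\mathcal Z_{10}$ for $k\in\mathbb N$; two elements are equal iff all their digits agree. For $k\in\mathbb N$, $[x]_k=\sum_{i=0}^k x_i10^{-i}\in\mathbb Q$. Order on $\mathcal R$: $x\preceq y$ iff $[x]_k\le [y]_k$ for all $k\in\mathbb N$. Every nonempty bounded above (below) subset of $(\mathcal R,\preceq)$ has a supremum (infimum); $\sup$ and $\inf$ are taken in $(\mathcal R,\preceq)$. $x\sim y$ ("no gap") means that there is no $z\in\mathcal R\setminus\{x,y\}$ lying strictly between $x$ and $y$ with respect to $\preceq$; $\sim$ is an equivalence relation and $[x]$ denotes the class of $x$ in $\mathcal R/\sim$. $\mathbb Q$ is regarded as a subset of $\mathcal R$ via long division: $\alpha=q/p$ ($p\in\mathbb N$, $q\in\mathbb Z$) is identified with $\alpha_0.\alpha_1\alpha_2\cdots$, where $\alpha_0=\lfloor q/p\rfloor$, $\beta_0=q-\alpha_0p$, $\alpha_{k+1}=\lfloor 10\beta_k/p\rfloor$, $\beta_{k+1}=10\beta_k-\alpha_{k+1}p$. A Dedekind cut $(A|B)$ is a pair of nonempty subsets $A,B$ of $\mathbb Q$ such that $A\cap B=\emptyset$, $A\cup B=\mathbb Q$; $a<b$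 for all $a\in A$, $b\in B$; and $A$ contains no greatest element. $\mathbf{DR}$ is the set of all Dedekind cuts. For every Dedekind cut, $\sup A\sim\inf B$, so $[\sup A]=[\inf B]$. *)

theory Defs
  imports Complex_Main
begin

text \<open>
  The leading entry \<open>x 0\<close> is an arbitrary (possibly negative) integer, while all later digits
  are in \<open>{0..9}\<close>; thus \<open>-1.5\<close> stands for \<open>-1 + 5/10\<close>.  No identification
  is made between expansions ending in \<open>999...\<close> and \<open>000...\<close>.
\<close>

typedef decimal = "{x :: nat \<Rightarrow> int. \<forall>k\<ge>1. x k \<in> {0..9}}"
  morphisms digit Abs_decimal
  by (rule exI[of _ "\<lambda>_. 0"]) simp

setup_lifting type_definition_decimal

definition trunc :: "decimal \<Rightarrow> nat \<Rightarrow> rat" where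
  "trunc x k = (\<Sum>i=0..k. of_int (digit x i) / 10 ^ i)"

lemma decimal_eq_iff: "x = y \<longleftrightarrow> (\<forall>k. digit x k = digit y k)"
  by (auto simp: digit_inject[symmetric] fun_eq_iff)

lemma digit_range: "digit x (Suc k) \<in> {0..9}"
  using digit[of x] by auto

text \<open>Scaled to an integer, the truncation is easier to compute with.\<close>

primrec itrunc :: "decimal \<Rightarrow> nat \<Rightarrow> int" where
  "itrunc x 0 = digit x 0"
| "itrunc x (Suc k) = 10 * itrunc x k + digit x (Suc k)"

lemma trunc_itrunc: "trunc x k = of_int (itrunc x k) / 10 ^ k"
  by (induction k) (auto simp: trunc_def field_simps)

lemma trunc_le_iff: "trunc x k \<le> trunc y k \<longleftrightarrow> itrunc x k \<le> itrunc y k"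
  by (simp add: trunc_itrunc divide_le_cancel)

lemma itrunc_div: "itrunc x k = itrunc x (Suc k) div 10"
  using digit_range[of x k] by simp

lemma itrunc_mod: "digit x (Suc k) = itrunc x (Suc k) mod 10"
  using digit_range[of x k] by simp

lemma itrunc_le_mono:
  assumes "itrunc x k \<le> itrunc y k" "j \<le> k"
  shows "itrunc x j \<le> itrunc y j"
  using assms(2,1)
proof (induction rule: inc_induct)
  case (step n)
  then show ?case
    using zdiv_mono1[of "itrunc x (Suc n)" "itrunc y (Suc n)" 10]
    by (simp only: itrunc_div[symmetric])
qed simp

lemma itrunc_inject: "(\<And>k. itrunc x k = itrunc y k) \<Longrightarrow> x = y"
  unfolding decimal_eq_iff
proof
  fix k assume eq: "\<And>k. itrunc x k = itrunc y k"
  show "digit x k = digit y k"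
  proof (cases k)
    case 0
    then show ?thesis using eq[of 0] by simp
  next
    case (Suc j)
    then show ?thesis by (simp only: itrunc_mod eq)
  qed
qed

lemma decimal_of_itrunc:
  assumes "\<And>k. m k = m (Suc k) div (10 :: int)"
  shows "\<exists>x. \<forall>k. itrunc x k = m k"
proof -
  define f where "f k = (if k = 0 then m 0 else m k mod 10)" for k
  have "f \<in> {x. \<forall>k\<ge>1. x k \<in> {0..9}}"
    using pos_mod_bound[of "10::int"] by (auto simp: f_def)
  then have d: "digit (Abs_decimal f) = f"
    by (rule Abs_decimal_inverse)
  have "itrunc (Abs_decimal f) k = m k" for k
  proof (induction k)
    case 0
    then show ?case by (simp only: itrunc.simps d) (simp add: f_def)
  next
    case (Suc k)
    have "itrunc (Abs_decimal f) (Suc k) = 10 * m k + m (Suc k) mod 10"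
      by (simp only: itrunc.simps d Suc.IH) (simp add: f_def)
    also have "\<dots> = 10 * (m (Suc k) div 10) + m (Suc k) mod 10"
      using assms[of k] by argo
    also have "\<dots> = m (Suc k)" by simp
    finally show ?case .
  qed
  then show ?thesis by blast
qed

instantiation decimal :: linorder
begin

definition less_eq_decimal :: "decimal \<Rightarrow> decimal \<Rightarrow> bool" where
  "x \<le> y \<longleftrightarrow> (\<forall>k\<ge>1. trunc x k \<le> trunc y k)"

definition less_decimal :: "decimal \<Rightarrow> decimal \<Rightarrow> bool" where
  "(x :: decimal) < y \<longleftrightarrow> x \<le> y \<and> \<not> y \<le> x"

lemma decimal_le_iff_itrunc: "x \<le> y \<longleftrightarrow> (\<forall>k. itrunc x k \<le> itrunc y k)"
proof -
  have "itrunc x k \<le> itrunc y k" if "\<forall>k\<ge>1. itrunc x k \<le> itrunc y k" for k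
    by (rule itrunc_le_mono[of x "Suc k"]) (use that in \<open>simp_all del: itrunc.simps\<close>)
  then show ?thesis
    unfolding less_eq_decimal_def trunc_le_iff by blast
qed

instance
proof
  fix x y z :: decimal
  show "x < y \<longleftrightarrow> x \<le> y \<and> \<not> y \<le> x"
    by (rule less_decimal_def)
  show "x \<le> x" "x \<le> y \<Longrightarrow> y \<le> z \<Longrightarrow> x \<le> z"
    unfolding decimal_le_iff_itrunc by (auto intro: order_trans)
  show "x \<le> y \<Longrightarrow> y \<le> x \<Longrightarrow> x = y"
    unfolding decimal_le_iff_itrunc by (auto intro: itrunc_inject order_antisym)
  show "x \<le> y \<or> y \<le> x"
    unfolding decimal_le_iff_itrunc
    by (meson itrunc_le_mono linorder_linear)
qed

end

lemma decimal_lub_exists: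
  fixes S :: "decimal set"
  assumes "S \<noteq> {}" and "\<And>x. x \<in> S \<Longrightarrow> x \<le> b"
  shows "\<exists>s. (\<forall>x\<in>S. x \<le> s) \<and> (\<forall>u. (\<forall>x\<in>S. x \<le> u) \<longrightarrow> s \<le> u)"
proof -
  define P where "P k m \<longleftrightarrow> (\<exists>x\<in>S. itrunc x k = m) \<and> (\<forall>x\<in>S. itrunc x k \<le> m)" for k m
  have ex: "\<exists>m. P k m" for k
  proof -
    obtain a where a: "a \<in> S" using assms(1) by blast
    let ?I = "(\<lambda>x. itrunc x k) ` {x\<in>S. itrunc a k \<le> itrunc x k}"
    have fin: "finite ?I"
      by (rule finite_subset[of _ "{itrunc a k..itrunc b k}"])
         (use assms(2) in \<open>auto simp: decimal_le_iff_itrunc\<close>)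
    have ne: "?I \<noteq> {}" using a by blast
    have "Max ?I \<in> ?I" by (rule Max_in[OF fin ne])
    moreover have "itrunc x k \<le> Max ?I" if "x \<in> S" for x
    proof (cases "itrunc a k \<le> itrunc x k")
      case True
      then show ?thesis using that by (intro Max_ge[OF fin]) auto
    next
      case False
      moreover have "itrunc a k \<le> Max ?I" using a by (intro Max_ge[OF fin]) auto
      ultimately show ?thesis by linarith
    qed
    ultimately show ?thesis unfolding P_def by (intro exI[of _ "Max ?I"]) auto
  qed
  then obtain m where m: "\<And>k. P k (m k)" by metis
  have "m k = m (Suc k) div 10" for k
  proof (rule order_antisym)
    obtain x where x: "x \<in> S" "itrunc x k = m k" using m[of k] unfolding P_def by blast
    have "itrunc x (Suc k) \<le> m (Suc k)" using m[of "Suc k"] x unfolding P_def by blast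
    then have "itrunc x (Suc k) div 10 \<le> m (Suc k) div 10"
      by (rule zdiv_mono1) simp
    then show "m k \<le> m (Suc k) div 10"
      by (simp only: itrunc_div[symmetric] x(2))
    obtain y where y: "y \<in> S" "itrunc y (Suc k) = m (Suc k)"
      using m[of "Suc k"] unfolding P_def by blast
    have "itrunc y k \<le> m k" using m[of k] y unfolding P_def by blast
    then show "m (Suc k) div 10 \<le> m k"
      by (simp only: itrunc_div[symmetric] y(2)[symmetric])
  qed
  then obtain s where s: "\<And>k. itrunc s k = m k"
    using decimal_of_itrunc[of m] by blast
  show ?thesis
  proof (intro exI[of _ s] conjI ballI allI impI)
    fix x assume "x \<in> S"
    then show "x \<le> s" using m s unfolding decimal_le_iff_itrunc P_def by metis
  next
    fix u assume "\<forall>x\<in>S. x \<le> u"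
    then show "s \<le> u" using m s unfolding decimal_le_iff_itrunc P_def by metis
  qed
qed

lemma decimal_glb_exists:
  fixes S :: "decimal set"
  assumes "S \<noteq> {}" and "\<And>x. x \<in> S \<Longrightarrow> b \<le> x"
  shows "\<exists>s. (\<forall>x\<in>S. s \<le> x) \<and> (\<forall>u. (\<forall>x\<in>S. u \<le> x) \<longrightarrow> u \<le> s)"
proof -
  let ?L = "{l. \<forall>x\<in>S. l \<le> x}"
  obtain a where a: "a \<in> S" using assms(1) by blast
  have "b \<in> ?L" using assms(2) by simp
  then have "?L \<noteq> {}" by (metis empty_iff)
  moreover have "l \<le> a" if "l \<in> ?L" for l using that a by simp
  ultimately have "\<exists>s. (\<forall>l\<in>?L. l \<le> s) \<and> (\<forall>u. (\<forall>l\<in>?L. l \<le> u) \<longrightarrow> s \<le> u)"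
    by (rule decimal_lub_exists)
  then obtain s where "\<forall>l\<in>?L. l \<le> s" "\<forall>u. (\<forall>l\<in>?L. l \<le> u) \<longrightarrow> s \<le> u"
    by blast
  then show ?thesis by (intro exI[of _ s]) blast
qed

instantiation decimal :: conditionally_complete_linorder
begin

definition inf_decimal :: "decimal \<Rightarrow> decimal \<Rightarrow> decimal" where
  "inf_decimal = min"

definition sup_decimal :: "decimal \<Rightarrow> decimal \<Rightarrow> decimal" where
  "sup_decimal = max"

definition Sup_decimal :: "decimal set \<Rightarrow> decimal" where
  "Sup (S :: decimal set) = (LEAST u. \<forall>x\<in>S. x \<le> u)"

definition Inf_decimal :: "decimal set \<Rightarrow> decimal" where
  "Inf (S :: decimal set) = (GREATEST l. \<forall>x\<in>S. l \<le> x)"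

lemma Sup_decimal_lub:
  fixes S :: "decimal set"
  assumes "S \<noteq> {}" "bdd_above S"
  shows "(\<forall>x\<in>S. x \<le> Sup S) \<and> (\<forall>u. (\<forall>x\<in>S. x \<le> u) \<longrightarrow> Sup S \<le> u)"
proof -
  obtain s where s: "\<forall>x\<in>S. x \<le> s" "\<forall>u. (\<forall>x\<in>S. x \<le> u) \<longrightarrow> s \<le> u"
    using decimal_lub_exists[of S] assms unfolding bdd_above_def by blast
  have "Sup S = s"
    unfolding Sup_decimal_def by (rule Least_equality) (use s in auto)
  then show ?thesis using s by blast
qed

lemma Inf_decimal_glb:
  fixes S :: "decimal set"
  assumes "S \<noteq> {}" "bdd_below S"
  shows "(\<forall>x\<in>S. Inf S \<le> x) \<and> (\<forall>l. (\<forall>x\<in>S. l \<le> x) \<longrightarrow> l \<le> Inf S)"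
proof -
  obtain s where s: "\<forall>x\<in>S. s \<le> x" "\<forall>u. (\<forall>x\<in>S. u \<le> x) \<longrightarrow> u \<le> s"
    using decimal_glb_exists[of S] assms unfolding bdd_below_def by blast
  have "Inf S = s"
    unfolding Inf_decimal_def by (rule Greatest_equality) (use s in auto)
  then show ?thesis using s by blast
qed

instance
proof
  fix x y z :: decimal and S :: "decimal set"
  show "inf x y \<le> x" "inf x y \<le> y" "x \<le> y \<Longrightarrow> x \<le> z \<Longrightarrow> x \<le> inf y z"
    unfolding inf_decimal_def by (rule min.cobounded1 min.cobounded2 min.boundedI; assumption)+
  show "x \<le> sup x y" "y \<le> sup x y" "y \<le> x \<Longrightarrow> z \<le> x \<Longrightarrow> sup y z \<le> x"
    unfolding sup_decimal_def by (rule max.cobounded1 max.cobounded2 max.boundedI; assumption)+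
  show "Inf S \<le> x" if "x \<in> S" "bdd_below S"
    using Inf_decimal_glb[of S] that by blast
  show "z \<le> Inf S" if "S \<noteq> {}" and z: "\<And>x. x \<in> S \<Longrightarrow> z \<le> x"
  proof -
    have "bdd_below S" using z by (rule bdd_belowI)
    then show ?thesis using Inf_decimal_glb[of S] that by blast
  qed
  show "x \<le> Sup S" if "x \<in> S" "bdd_above S"
    using Sup_decimal_lub[of S] that by blast
  show "Sup S \<le> z" if "S \<noteq> {}" and z: "\<And>x. x \<in> S \<Longrightarrow> x \<le> z"
  proof -
    have "bdd_above S" using z by (rule bdd_aboveI)
    then show ?thesis using Sup_decimal_lub[of S] that by blast
  qed
qed

end

definition no_gap :: "decimal \<Rightarrow> decimal \<Rightarrow> bool"  (infix \<open>\<sim>\<close> 50) where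
  "x \<sim> y \<longleftrightarrow> \<not> (\<exists>z. z \<notin> {x, y} \<and> (x \<le> z \<and> z \<le> y \<or> y \<le> z \<and> z \<le> x))"

definition no_gap_rel :: "(decimal \<times> decimal) set" where
  "no_gap_rel = {(x, y). x \<sim> y}"

definition gap_class :: "decimal \<Rightarrow> decimal set" where
  "gap_class x = no_gap_rel `` {x}"

primrec ld_rem :: "int \<Rightarrow> int \<Rightarrow> nat \<Rightarrow> int" where
  "ld_rem q p 0 = q - (q div p) * p"
| "ld_rem q p (Suc k) = 10 * ld_rem q p k - (10 * ld_rem q p k div p) * p"

primrec ld_digit :: "int \<Rightarrow> int \<Rightarrow> nat \<Rightarrow> int" where
  "ld_digit q p 0 = q div p"
| "ld_digit q p (Suc k) = 10 * ld_rem q p k div p"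

lemma ld_rem_bounds: "p > 0 \<Longrightarrow> 0 \<le> ld_rem q p k \<and> ld_rem q p k < p"
  by (cases k) (simp_all add: minus_div_mult_eq_mod)

lemma ld_digit_range:
  assumes "p > 0" "k \<ge> 1"
  shows "ld_digit q p k \<in> {0..9}"
proof -
  obtain j where k: "k = Suc j" using assms(2) by (cases k) auto
  define r d where "r = ld_rem q p j" and "d = 10 * r div p"
  have r: "0 \<le> r" "r < p" using ld_rem_bounds[OF assms(1)] by (auto simp: r_def)
  have "0 \<le> d" unfolding d_def using r by (intro div_int_pos_iff[THEN iffD2]) linarith
  moreover have "d < 10"
  proof (rule ccontr)
    assume "\<not> d < 10"
    then have "10 * p \<le> d * p" using assms(1) by (intro mult_right_mono) simp_all
    also have "d * p = 10 * r - 10 * r mod p"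
      unfolding d_def by (rule minus_mod_eq_div_mult[symmetric])
    also have "\<dots> \<le> 10 * r" using assms(1) by simp
    finally show False using r by linarith
  qed
  ultimately show ?thesis by (simp add: k r_def d_def)
qed

lift_definition decimal_of_rat :: "rat \<Rightarrow> decimal" is
  "\<lambda>\<alpha>. case quotient_of \<alpha> of (q, p) \<Rightarrow> ld_digit q p"
  using ld_digit_range quotient_of_denom_pos by (auto split: prod.split)

text \<open>\<^const>\<open>quotient_of\<close> picks the fraction in lowest terms; any other representation
  with a positive denominator yields the same digits.\<close>

lemma ld_rem_scale: "c > 0 \<Longrightarrow> ld_rem (c * q) (c * p) k = c * ld_rem q p k"
proof (induction k)
  case 0
  show ?case
    unfolding ld_rem.simps minus_div_mult_eq_mod by (rule mult_mod_right[symmetric])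
next
  case (Suc k)
  have "ld_rem (c * q) (c * p) (Suc k) = (10 * (c * ld_rem q p k)) mod (c * p)"
    unfolding ld_rem.simps minus_div_mult_eq_mod Suc.IH[OF Suc.prems] by (rule refl)
  also have "10 * (c * ld_rem q p k) = c * (10 * ld_rem q p k)" by (rule mult.left_commute)
  also have "c * (10 * ld_rem q p k) mod (c * p) = c * (10 * ld_rem q p k mod p)"
    by (rule mult_mod_right[symmetric])
  also have "\<dots> = c * ld_rem q p (Suc k)"
    unfolding ld_rem.simps minus_div_mult_eq_mod by (rule refl)
  finally show ?case .
qed

lemma ld_digit_scale: "c > 0 \<Longrightarrow> ld_digit (c * q) (c * p) k = ld_digit q p k"
proof (cases k)
  case (Suc j)
  assume c: "c > 0"
  have "10 * (c * ld_rem q p j) = c * (10 * ld_rem q p j)" by simp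
  with c show ?thesis
    by (simp only: Suc ld_digit.simps ld_rem_scale div_mult_mult1 less_imp_neq[THEN not_sym]) simp
qed simp

lemma digit_decimal_of_rat:
  assumes "p > 0"
  shows "digit (decimal_of_rat (Fract q p)) k = ld_digit q p k"
proof -
  let ?g = "gcd q p"
  have g: "?g > 0" using assms by simp
  have "quotient_of (Fract q p) = (q div ?g, p div ?g)"
    unfolding quotient_of_Fract Rat.normalize_def Let_def using assms by (simp only: fst_conv snd_conv if_True)
  then have "digit (decimal_of_rat (Fract q p)) k = ld_digit (q div ?g) (p div ?g) k"
    by (simp only: decimal_of_rat.rep_eq prod.case)
  also have "\<dots> = ld_digit (?g * (q div ?g)) (?g * (p div ?g)) k"
    by (rule ld_digit_scale[OF g, symmetric])
  also have "?g * (q div ?g) = q" by (rule dvd_mult_div_cancel) (rule gcd_dvd1)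
  also have "?g * (p div ?g) = p" by (rule dvd_mult_div_cancel) (rule gcd_dvd2)
  finally show ?thesis .
qed

definition dedekind_cuts :: "(rat set \<times> rat set) set" where
  "dedekind_cuts = {(A, B). A \<noteq> {} \<and> B \<noteq> {} \<and> A \<inter> B = {} \<and> A \<union> B = UNIV \<and>
     (\<forall>a\<in>A. \<forall>b\<in>B. a < b) \<and> \<not> (\<exists>m\<in>A. \<forall>a\<in>A. a \<le> m)}"

definition cut_class :: "rat set \<times> rat set \<Rightarrow> decimal set" where
  "cut_class = (\<lambda>(A, B). gap_class (Sup (decimal_of_rat ` A)))"

end

theory Submission
  imports Defs
begin

text \<open>
  Every formal decimal \<open>x\<close> has a real value, the limit of its truncations. The value is monotone,
  agrees with the given number on rationals, and \<open>x \<sim> y\<close> holds iff the values of \<open>x\<close> and \<open>y\<close>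
  coincide: rationals lie densely between distinct values, and two distinct decimals of the same
  value \<open>v\<close> eventually have the scaled truncations \<open>10 ^ k * v - 1\<close> and \<open>10 ^ k * v\<close>, which
  leaves no room for a third one. Hence the quotient is the real line. For a cut \<open>(A, B)\<close> the values
  of \<open>sup A\<close> and \<open>inf B\<close> lie between \<open>A\<close> and \<open>B\<close>, and by density only one real number does;
  conversely, this number determines the cut.
\<close>

section \<open>The real value of a formal decimal\<close>

definition val :: "decimal \<Rightarrow> real" where
  "val x = (SUP k. real_of_int (itrunc x k) / 10 ^ k)"

lemma incseq_itrunc: "incseq (\<lambda>k. real_of_int (itrunc x k) / 10 ^ k)"
proof (rule incseq_SucI)
  fix k
  show "real_of_int (itrunc x k) / 10 ^ k \<le> real_of_int (itrunc x (Suc k)) / 10 ^ Suc k"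
    using digit_range[of x k] by (simp add: field_simps)
qed

text \<open>These are the upper ends of the nested decimal intervals; they decrease because a digit
  is at most 9.\<close>

lemma decseq_itrunc: "decseq (\<lambda>k. (real_of_int (itrunc x k) + 1) / 10 ^ k)"
proof (rule decseq_SucI)
  fix k
  have "real_of_int (digit x (Suc k)) \<le> 9" using digit_range[of x k] by simp
  then show "(real_of_int (itrunc x (Suc k)) + 1) / 10 ^ Suc k \<le> (real_of_int (itrunc x k) + 1) / 10 ^ k"
    by (simp add: field_simps)
qed

lemma itrunc_lower_le_upper:
  "real_of_int (itrunc x j) / 10 ^ j \<le> (real_of_int (itrunc x k) + 1) / 10 ^ k"
proof -
  let ?n = "max j k"
  have "real_of_int (itrunc x j) / 10 ^ j \<le> real_of_int (itrunc x ?n) / 10 ^ ?n"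
    by (rule incseqD[OF incseq_itrunc]) simp
  also have "\<dots> \<le> (real_of_int (itrunc x ?n) + 1) / 10 ^ ?n"
    by (simp add: divide_right_mono)
  also have "\<dots> \<le> (real_of_int (itrunc x k) + 1) / 10 ^ k"
    by (rule decseqD[OF decseq_itrunc]) simp
  finally show ?thesis .
qed

lemma bdd_above_itrunc: "bdd_above (range (\<lambda>k. real_of_int (itrunc x k) / 10 ^ k))"
  by (rule bdd_aboveI2) (rule itrunc_lower_le_upper)

lemma itrunc_le_val: "real_of_int (itrunc x k) \<le> 10 ^ k * val x"
proof -
  have "real_of_int (itrunc x k) / 10 ^ k \<le> val x"
    unfolding val_def by (rule cSUP_upper[OF UNIV_I bdd_above_itrunc])
  then show ?thesis by (simp add: field_simps)
qed

text \<open>The bound cannot be strict: a tail of nines attains it.\<close>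

lemma val_le_itrunc: "10 ^ k * val x \<le> real_of_int (itrunc x k) + 1"
proof -
  have "val x \<le> (real_of_int (itrunc x k) + 1) / 10 ^ k"
    unfolding val_def by (rule cSUP_least) (auto intro: itrunc_lower_le_upper)
  then show ?thesis by (simp add: field_simps)
qed

lemma val_mono: "x \<le> y \<Longrightarrow> val x \<le> val y"
  unfolding val_def
  by (rule cSUP_mono[OF _ bdd_above_itrunc])
     (auto simp: decimal_le_iff_itrunc intro!: exI divide_right_mono)

lemma val_less_imp_less: "val x < val y \<Longrightarrow> x < y"
  using val_mono[of y x] by (meson not_le)

text \<open>After scaling by \<open>10 ^ k\<close>, \<open>v\<close> and \<open>val x\<close> lie in
  the same interval of length 1, while any nonzero difference would exceed 1 for large
  \<open>k\<close>.\<close>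

lemma val_eqI:
  assumes "\<And>k. real_of_int (itrunc x k) \<le> 10 ^ k * v" "\<And>k. 10 ^ k * v \<le> real_of_int (itrunc x k) + 1"
  shows "val x = v"
proof (rule ccontr)
  assume "val x \<noteq> v"
  then have pos: "0 < \<bar>val x - v\<bar>" by simp
  obtain k where "1 / \<bar>val x - v\<bar> < 10 ^ k"
    using real_arch_pow[of 10 "1 / \<bar>val x - v\<bar>"] by auto
  then have "1 < 10 ^ k * \<bar>val x - v\<bar>"
    using pos by (simp add: field_simps)
  also have "\<dots> = \<bar>10 ^ k * val x - 10 ^ k * v\<bar>"
    by (simp add: abs_mult right_diff_distrib[symmetric])
  also have "\<dots> \<le> 1"
    using assms(1,2)[of k] itrunc_le_val[of x k] val_le_itrunc[of k x] by linarith
  finally show False by simp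
qed

section \<open>Long division preserves the value\<close>

text \<open>The invariant of long division: step \<open>k\<close> has produced quotient and
  remainder of \<open>10 ^ k * q\<close> by \<open>p\<close>.\<close>

lemma itrunc_decimal_of_rat:
  assumes "p > 0"
  shows "itrunc (decimal_of_rat (Fract q p)) k * p + ld_rem q p k = 10 ^ k * q"
proof (induction k)
  case (Suc k)
  let ?n = "itrunc (decimal_of_rat (Fract q p)) k" and ?r = "ld_rem q p k"
  have "itrunc (decimal_of_rat (Fract q p)) (Suc k) * p + ld_rem q p (Suc k) = 10 * (?n * p + ?r)"
    unfolding itrunc.simps digit_decimal_of_rat[OF assms] ld_digit.simps ld_rem.simps
    by (simp add: algebra_simps)
  then show ?case by (simp add: Suc.IH)
qed (simp add: digit_decimal_of_rat[OF assms])

lemma val_decimal_of_rat: "val (decimal_of_rat a) = real_of_rat a"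
proof (cases a)
  case (Fract q p)
  show ?thesis
  proof (rule val_eqI)
    fix k
    let ?n = "itrunc (decimal_of_rat a) k"
    have "?n * p + ld_rem q p k = 10 ^ k * q"
      unfolding Fract(1) by (rule itrunc_decimal_of_rat[OF Fract(2)])
    then have "?n * p \<le> 10 ^ k * q" "10 ^ k * q \<le> (?n + 1) * p"
      using ld_rem_bounds[OF Fract(2), of q k] by (auto simp: algebra_simps)
    then have "real_of_int (?n * p) \<le> real_of_int (10 ^ k * q)"
      "real_of_int (10 ^ k * q) \<le> real_of_int ((?n + 1) * p)"
      by (simp_all only: of_int_le_iff)
    then show "real_of_int ?n \<le> 10 ^ k * real_of_rat a"
      "10 ^ k * real_of_rat a \<le> real_of_int ?n + 1"
      using Fract(2) by (simp_all add: Fract(1) of_rat_rat field_simps)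
  qed
qed

lemma decimal_of_rat_mono: "a < b \<Longrightarrow> decimal_of_rat a < decimal_of_rat b"
  by (rule val_less_imp_less) (simp add: val_decimal_of_rat of_rat_less)

section \<open>No gap means equal value\<close>

text \<open>With \<open>v\<close> the common value,
  \<open>itrunc y k \<le> 10 ^ k * v \<le> itrunc x k + 1\<close>. Once the integers
  \<open>itrunc x k < itrunc y k\<close> differ, all three terms must agree.\<close>

lemma less_same_val_itrunc:
  assumes "x < y" "val x = val y"
  shows "\<exists>n. \<forall>k\<ge>n. real_of_int (itrunc y k) = 10 ^ k * val x
    \<and> real_of_int (itrunc x k) = 10 ^ k * val x - 1"
proof -
  obtain n where n: "itrunc x n < itrunc y n"
    using assms(1) by (auto simp: less_decimal_def decimal_le_iff_itrunc not_le)
  have "real_of_int (itrunc y k) = 10 ^ k * val x \<and> real_of_int (itrunc x k) = 10 ^ k * val x - 1"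
    if "n \<le> k" for k
  proof -
    \<comment> \<open>The reverse inequality at \<open>k\<close> would pass down to
      \<open>n\<close>.\<close>
    have "itrunc x k < itrunc y k" using itrunc_le_mono[of y k x n] n that by linarith
    then show ?thesis
      using itrunc_le_val[of y k] val_le_itrunc[of k x] assms(2) by auto
  qed
  then show ?thesis by blast
qed

text \<open>As the larger of \<open>x, z\<close> and the smaller of \<open>z, y\<close>, the decimal
  \<open>z\<close> would have two different truncations at a late index.\<close>

lemma same_val_not_between:
  assumes "x < z" "z < y" "val x = val y"
  shows False
proof -
  have v: "val x = val z" "val z = val y"
    using val_mono[OF less_imp_le[OF assms(1)]] val_mono[OF less_imp_le[OF assms(2)]] assms(3)
    by linarith+
  obtain n where n: "\<forall>k\<ge>n. real_of_int (itrunc z k) = 10 ^ k * val x"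
    using less_same_val_itrunc[OF assms(1) v(1)] by blast
  obtain n' where n': "\<forall>k\<ge>n'. real_of_int (itrunc z k) = 10 ^ k * val z - 1"
    using less_same_val_itrunc[OF assms(2) v(2)] by blast
  show False
    using n[rule_format, of "max n n'"] n'[rule_format, of "max n n'"] v by simp
qed

lemma val_less_imp_gap:
  assumes "val x < val y"
  shows "\<exists>z. x < z \<and> z < y"
proof -
  obtain r where "val x < real_of_rat r" "real_of_rat r < val y"
    using of_rat_dense[OF assms] by blast
  then show ?thesis
    by (intro exI[of _ "decimal_of_rat r"]) (auto intro: val_less_imp_less simp: val_decimal_of_rat)
qed

lemma no_gap_iff_val: "x \<sim> y \<longleftrightarrow> val x = val y"
proof
  assume "x \<sim> y"
  then have "\<not> (\<exists>z. x < z \<and> z < y)" "\<not> (\<exists>z. y < z \<and> z < x)"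
    unfolding no_gap_def by auto
  then show "val x = val y"
    using val_less_imp_gap[of x y] val_less_imp_gap[of y x] by (meson linorder_neqE)
next
  assume "val x = val y"
  then show "x \<sim> y"
    unfolding no_gap_def
    using same_val_not_between[of x _ y] same_val_not_between[of y _ x]
    by (metis insert_iff order_le_less)
qed

lemma gap_class_val: "gap_class x = {y. val y = val x}"
  by (auto simp: gap_class_def no_gap_rel_def no_gap_iff_val)

lemma gap_class_eq_iff: "gap_class x = gap_class y \<longleftrightarrow> val x = val y"
  unfolding gap_class_val by auto

section \<open>Cuts as real numbers\<close>

text \<open>A rational \<open>r\<close> goes into the upper set, since the lower one may have no
  greatest element.\<close>

definition cut_of_real :: "real \<Rightarrow> rat set \<times> rat set" where
  "cut_of_real r = ({a. real_of_rat a < r}, {b. r \<le> real_of_rat b})"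

lemma cut_of_real_mem: "cut_of_real r \<in> dedekind_cuts"
proof -
  obtain a where "real_of_rat a < r" using of_rat_dense[of "r - 1" r] by auto
  moreover obtain b where "r < real_of_rat b" using of_rat_dense[of r "r + 1"] by auto
  then have "\<not> real_of_rat b < r" by simp
  moreover have "\<exists>a. real_of_rat a < r \<and> m < a" if "real_of_rat m < r" for m
    using of_rat_dense[OF that] by (auto simp: of_rat_less)
  moreover have "a < b" if "real_of_rat a < r" "r \<le> real_of_rat b" for a b
    using less_le_trans[OF that] by (simp add: of_rat_less)
  ultimately show ?thesis
    unfolding dedekind_cuts_def cut_of_real_def by (auto simp: not_le not_less)
qed

lemma cut_eq_cut_of_real:
  assumes cut: "(A, B) \<in> dedekind_cuts"
    and lower: "\<And>a. a \<in> A \<Longrightarrow> real_of_rat a \<le> r" and upper: "\<And>b. b \<in> B \<Longrightarrow> r \<le> real_of_rat b"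
  shows "(A, B) = cut_of_real r"
proof -
  have part: "A \<inter> B = {}" "A \<union> B = UNIV" and no_max: "\<not> (\<exists>m\<in>A. \<forall>a\<in>A. a \<le> m)"
    using cut by (auto simp: dedekind_cuts_def)
  have "real_of_rat a < r" if a: "a \<in> A" for a
  proof -
    \<comment> \<open>A larger element of \<open>A\<close> turns the weak bound by \<open>r\<close>
      into a strict one.\<close>
    obtain a' where "a' \<in> A" "a < a'" using no_max a by (auto simp: not_le)
    then show ?thesis using lower[of a'] by (meson of_rat_less less_le_trans)
  qed
  then have "A = {a. real_of_rat a < r}"
    using part upper by (fastforce simp: not_le)
  moreover have "B = - A" using part by blast
  ultimately show ?thesis by (auto simp: cut_of_real_def)
qed

lemma inj_cut_of_real: "inj cut_of_real"
proof (rule injI)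
  fix r s assume eq: "cut_of_real r = cut_of_real s"
  have "\<not> u < v" if "cut_of_real u = cut_of_real v" for u v
  proof
    assume "u < v"
    then obtain q where "u < real_of_rat q" "real_of_rat q < v" using of_rat_dense by blast
    then show False using that by (auto simp: cut_of_real_def set_eq_iff dest: spec[of _ q])
  qed
  from this[OF eq] this[OF eq[symmetric]] show "r = s" by simp
qed

text \<open>Since \<open>?s \<le> ?i\<close>, both lie between the images of \<open>A\<close> and
  \<open>B\<close>, and so do their values; each value therefore induces the given cut.\<close>

lemma cut_of_real_val_Sup_Inf:
  assumes cut: "(A, B) \<in> dedekind_cuts"
  shows "cut_of_real (val (Sup (decimal_of_rat ` A))) = (A, B)"
    and "cut_of_real (val (Inf (decimal_of_rat ` B))) = (A, B)"
proof -
  let ?s = "Sup (decimal_of_rat ` A)" and ?i = "Inf (decimal_of_rat ` B)"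
  have ne: "A \<noteq> {}" "B \<noteq> {}" and "\<And>a b. a \<in> A \<Longrightarrow> b \<in> B \<Longrightarrow> a < b"
    using cut by (auto simp: dedekind_cuts_def)
  then have le: "decimal_of_rat a \<le> decimal_of_rat b" if "a \<in> A" "b \<in> B" for a b
    using that by (meson decimal_of_rat_mono less_imp_le)
  have bdd: "bdd_above (decimal_of_rat ` A)" "bdd_below (decimal_of_rat ` B)"
    using ne le by (meson bdd_aboveI2 bdd_belowI2 ex_in_conv)+
  have s: "decimal_of_rat a \<le> ?s" if "a \<in> A" for a
    using that bdd(1) by (rule cSUP_upper)
  have i: "?i \<le> decimal_of_rat b" if "b \<in> B" for b
    using bdd(2) that by (rule cINF_lower)
  have si: "?s \<le> ?i"
    using ne le by (intro cSUP_least cINF_greatest)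
  have lower: "decimal_of_rat a \<le> ?i" if "a \<in> A" for a
    using order_trans[OF s[OF that] si] .
  have upper: "?s \<le> decimal_of_rat b" if "b \<in> B" for b
    using order_trans[OF si i[OF that]] .
  show "cut_of_real (val ?s) = (A, B)"
    using s[THEN val_mono] upper[THEN val_mono]
    by (intro cut_eq_cut_of_real[OF cut, symmetric]) (simp_all add: val_decimal_of_rat)
  show "cut_of_real (val ?i) = (A, B)"
    using lower[THEN val_mono] i[THEN val_mono]
    by (intro cut_eq_cut_of_real[OF cut, symmetric]) (simp_all add: val_decimal_of_rat)
qed

theorem theorem6p4:
  shows "(\<forall>(A, B) \<in> dedekind_cuts.
           cut_class (A, B) = gap_class (Sup (decimal_of_rat ` A)) \<and>
           cut_class (A, B) = gap_class (Inf (decimal_of_rat ` B))) \<and>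
         bij_betw cut_class dedekind_cuts (UNIV // no_gap_rel)"
proof (intro conjI)
  show "\<forall>(A, B) \<in> dedekind_cuts.
           cut_class (A, B) = gap_class (Sup (decimal_of_rat ` A)) \<and>
           cut_class (A, B) = gap_class (Inf (decimal_of_rat ` B))"
    \<comment> \<open>The values of supremum and infimum induce the same cut, so they are equal by
      injectivity of \<open>cut_of_real\<close>.\<close>
    using cut_of_real_val_Sup_Inf
    by (auto simp: cut_class_def gap_class_eq_iff intro!: injD[OF inj_cut_of_real])
  show "bij_betw cut_class dedekind_cuts (UNIV // no_gap_rel)"
  proof (rule bij_betwI')
    fix C D assume "C \<in> dedekind_cuts" "D \<in> dedekind_cuts"
    then show "cut_class C = cut_class D \<longleftrightarrow> C = D"
      \<comment> \<open>\<open>cut_of_real\<close> recovers a cut from the value of its supremum, so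
        equal values force equal cuts.\<close>
      using cut_of_real_val_Sup_Inf(1)
      by (cases C, cases D) (auto simp: cut_class_def gap_class_eq_iff, (metis prod.inject)+)
  next
    fix C assume "C \<in> dedekind_cuts"
    show "cut_class C \<in> UNIV // no_gap_rel"
      by (cases C) (auto simp: cut_class_def gap_class_def intro: quotientI)
  next
    fix K assume "K \<in> UNIV // no_gap_rel"
    then obtain x where K: "K = gap_class x"
      by (auto simp: gap_class_def elim: quotientE)
    \<comment> \<open>The preimage of the class of \<open>x\<close> is the cut at
      \<open>val x\<close>; its supremum may differ from \<open>x\<close>, but has the same
      value.\<close>
    obtain A B where AB: "cut_of_real (val x) = (A, B)" by fastforce
    then have cut: "(A, B) \<in> dedekind_cuts" using cut_of_real_mem[of "val x"] by simp
    have "val (Sup (decimal_of_rat ` A)) = val x"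
      using cut_of_real_val_Sup_Inf(1)[OF cut] AB by (intro injD[OF inj_cut_of_real]) simp
    then have "cut_class (A, B) = K"
      by (simp add: K cut_class_def gap_class_eq_iff)
    then show "\<exists>C\<in>dedekind_cuts. K = cut_class C" using cut by blast
  qed
qed

end
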